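(* Let $N,m,r$ be positive integers with $r<m$ and $r\le N$, and let $\lambda>0$. Let $X\in\mathbb{R}^{N\times m}$, $A\in\mathbb{R}^{m\times r}$, $U\in\mathbb{R}^{N\times r}$ be random matrices on a common probability space, and put $Z=XA$ and $\Sigma_X=X^\top X$. Assume: (i) almost surely, $\Sigma_X$ is not a scalar multiple of $I_m$; (ii) conditionally on $X$, the distribution of $A$ is absolutely continuous with respect to Lebesgue measure on $\mathbb{R}^{m\times r}$; (iii) the joint distribution of $(Z,U)$ is absolutely continuous with respect to Lebesgue measure on $\mathbb{R}^{N\times r}\times\mathbb{R}^{N\times r}$. Let $S=\operatorname{Col}(A)$, let $P_S^\perp$ be the orthogonal projector of $\mathbb{R}^m$ onto the orthogonal complement of $S$, and let $K_\lambda=(A^\top\Sigma_XA+\lambda I_r)^{-1}A^\top X^\top U$. Then $$\Pr\left(P_S^\perp\Sigma_XAK_\lambda=0\right)=0 .$$ Hence, for every $\eta>0$, the updated matrix $A^+=A-\eta\,\Sigma_XAK_\lambda$ satisfies $\operatorname{Col}(A^+)\nsubseteq\operatorname{Col}(A)$ almost surely.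
   Context: $\operatorname{Col}(\cdot)$ denotes the column space of a matrix. In the application, $X$ is the input activation of a layer $Y=X(W+AB)$ with low-rank factors $A,B$, $U=GB^\top$ is the backward signal (with $G$ the upstream gradient), and $\Sigma_XAK_\lambda$ is the reconstructed gradient $M^\top Z^\top U$ with $M=(Z^\top Z+\lambda I_r)^{-1}Z^\top X$; for the claim, $X$, $A$, $U$ are just random matrices satisfying the stated assumptions. *)

theory Defs
  imports "HOL-Probability.Probability"
begin

definition col_space :: "real^'c^'d \<Rightarrow> (real^'d) set" where
  "col_space A = span (columns A)"

text \<open>The matrix of the orthogonal projector onto a subspace; the description is only
  meaningful for subspaces, where it is justified by \<open>ex1_orth_projector\<close> below.\<close>

definition orth_projector :: "(real^'d) set \<Rightarrow> real^'d^'d" where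
  "orth_projector T = (THE P. \<forall>v. P *v v \<in> T \<and> v - P *v v \<in> T\<^sup>\<bottom>)"

lemma ex1_orth_projector:
  fixes T :: "(real^'d) set"
  assumes "subspace T"
  shows "\<exists>!P :: real^'d^'d. \<forall>v. P *v v \<in> T \<and> v - P *v v \<in> T\<^sup>\<bottom>"
proof -
  have uniq: "x = x'"
    if "x \<in> T" "x' \<in> T" "v - x \<in> T\<^sup>\<bottom>" "v - x' \<in> T\<^sup>\<bottom>" for x x' v :: "real^'d"
  proof -
    have "x - x' \<in> T"
      using that assms by (simp add: subspace_diff)
    moreover have "(v - x') - (v - x) \<in> T\<^sup>\<bottom>"
      using that subspace_orthogonal_comp subspace_diff by blast
    hence "x - x' \<in> T\<^sup>\<bottom>"
      by simp
    ultimately have "orthogonal (x - x') (x - x')"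
      by (auto simp: orthogonal_comp_def)
    thus ?thesis
      by (simp add: orthogonal_def)
  qed
  have "\<exists>x. x \<in> T \<and> v - x \<in> T\<^sup>\<bottom>" for v
  proof -
    obtain y z where "y \<in> span T" "\<And>w. w \<in> span T \<Longrightarrow> orthogonal z w" "v = y + z"
      using orthogonal_subspace_decomp_exists[of T v] by metis
    thus ?thesis
      using assms by (intro exI[of _ y])
        (auto simp: orthogonal_comp_def orthogonal_commute span_eq_iff[THEN iffD2])
  qed
  then obtain f where f: "f v \<in> T" "v - f v \<in> T\<^sup>\<bottom>" for v
    by metis
  have "linear f"
  proof (rule linearI)
    fix v w
    have "(v - f v) + (w - f w) \<in> T\<^sup>\<bottom>"
      using f subspace_orthogonal_comp subspace_add by blast
    hence "(v + w) - (f v + f w) \<in> T\<^sup>\<bottom>"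
      by (simp add: algebra_simps)
    thus "f (v + w) = f v + f w"
      using uniq f assms subspace_add by blast
  next
    fix c :: real and v
    have "c *\<^sub>R (v - f v) \<in> T\<^sup>\<bottom>"
      using f subspace_orthogonal_comp subspace_scale by blast
    hence "c *\<^sub>R v - c *\<^sub>R f v \<in> T\<^sup>\<bottom>"
      by (simp add: algebra_simps)
    thus "f (c *\<^sub>R v) = c *\<^sub>R f v"
      using uniq f assms subspace_scale by blast
  qed
  show ?thesis
  proof (rule ex1I[of _ "matrix f"])
    show "\<forall>v. matrix f *v v \<in> T \<and> v - matrix f *v v \<in> T\<^sup>\<bottom>"
      using f \<open>linear f\<close> by (simp add: matrix_works)
  next
    fix P :: "real^'d^'d"
    assume "\<forall>v. P *v v \<in> T \<and> v - P *v v \<in> T\<^sup>\<bottom>"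
    hence "P *v v = f v" for v
      using f uniq by blast
    hence "P *v v = matrix f *v v" for v
      using \<open>linear f\<close> by (simp add: matrix_works)
    thus "P = matrix f"
      by (simp add: matrix_eq)
  qed
qed

definition gram :: "real^'m^'n \<Rightarrow> real^'m^'m" where
  "gram X = transpose X ** X"

definition K_mat :: "real \<Rightarrow> real^'m^'n \<Rightarrow> real^'r^'m \<Rightarrow> real^'r^'n \<Rightarrow> real^'r^'r" where
  "K_mat lam X A U =
     matrix_inv (transpose A ** gram X ** A + lam *\<^sub>R mat 1) ** (transpose A ** transpose X ** U)"

text \<open>\<open>\<kappa>\<close> is a regular conditional distribution of \<open>Y\<close> given \<open>X\<close>: a Markov kernel such that
  \<open>\<kappa> (X \<omega>) B\<close> is a version of the conditional probability of \<open>Y \<in> B\<close> given \<open>\<sigma>(X)\<close>.\<close>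

definition regular_cond_distr ::
  "'w measure \<Rightarrow> ('w \<Rightarrow> 'a::topological_space) \<Rightarrow> ('w \<Rightarrow> 'b::topological_space)
     \<Rightarrow> ('a \<Rightarrow> 'b measure) \<Rightarrow> bool" where
  "regular_cond_distr M X Y \<kappa> \<longleftrightarrow>
     \<kappa> \<in> borel \<rightarrow>\<^sub>M prob_algebra borel \<and>
     (\<forall>B\<in>sets borel. AE \<omega> in M.
        real_cond_exp M (vimage_algebra (space M) X borel) (\<lambda>\<omega>. indicator B (Y \<omega>)) \<omega>
          = measure (\<kappa> (X \<omega>)) B)"

text \<open>Between Euclidean spaces a regular conditional distribution exists and is unique up to
  almost sure equality, so the existential quantifier does not depend on the version chosen.
  Requiring only \<open>P(Y \<in> B | X) = 0\<close> almost surely for each single Lebesgue null set \<open>B\<close> would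
  be strictly weaker (take \<open>Y = X\<close> uniform).\<close>

definition cond_abs_continuous ::
  "'w measure \<Rightarrow> ('w \<Rightarrow> 'a::topological_space) \<Rightarrow> ('w \<Rightarrow> 'b::euclidean_space) \<Rightarrow> bool" where
  "cond_abs_continuous M X Y \<longleftrightarrow>
     (\<exists>\<kappa>. regular_cond_distr M X Y \<kappa> \<and>
        (AE \<omega> in M. absolutely_continuous lborel (\<kappa> (X \<omega>))))"

end

theory Submission
  imports Defs
begin

text \<open>If \<open>P\<^sub>S\<^sup>\<bottom> \<Sigma> A K = 0\<close>, then \<open>\<Sigma> A K = A B\<close> for some \<open>B\<close>. Almost surely \<open>K\<close> is invertible, because
  \<open>det (Z\<^sup>T U)\<close> is a nonzero polynomial in \<open>(Z, U)\<close>; hence \<open>Col A\<close> would be \<open>\<Sigma>\<close>-invariant. For a fixed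
  non-scalar \<open>\<Sigma>\<close> the matrices \<open>A\<close> with \<open>\<Sigma>\<close>-invariant column space are zeros of a nonzero polynomial
  and so form a Lebesgue null set, which has conditional probability zero given \<open>X\<close>.

  The zero set of a nonzero polynomial \<open>f\<close> is null because, if \<open>f x\<^sub>0 \<noteq> 0\<close>, then \<open>t \<mapsto> f (x\<^sub>0 + t x)\<close> has
  finitely many zeros for every \<open>x\<close>; by Fubini, for some \<open>t \<noteq> 0\<close> almost every \<open>x\<close> satisfies
  \<open>f (x\<^sub>0 + t x) \<noteq> 0\<close>, and \<open>x \<mapsto> x\<^sub>0 + t x\<close> preserves null sets.\<close>

section \<open>Borel projections and null zero sets of polynomials\<close>

text \<open>Restricting the eliminated variable to a compact ball makes the projection closed;
  countably many balls exhaust the space, so the projection is an \<open>F_sigma\<close> set. This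
  gives measurability of events of the form "some matrix solves this equation".\<close>

lemma borel_closed_projection:
  fixes T :: "('a::euclidean_space \<times> 'b::euclidean_space) set"
  assumes "closed T"
  shows "{y. \<exists>x. (x, y) \<in> T} \<in> sets borel"
proof -
  have "{y. \<exists>x. (x, y) \<in> T} = (\<Union>n::nat. {y. \<exists>x. x \<in> cball 0 (real n) \<and> (x, y) \<in> T})"
    using real_arch_simple by fastforce
  moreover have "{y. \<exists>x. x \<in> cball 0 (real n) \<and> (x, y) \<in> T} \<in> sets borel" for n
    using closed_compact_projection[OF compact_cball assms, of 0 "real n"] by (rule borel_closed)
  ultimately show ?thesis
    by auto
qed

lemma real_polynomial_function_AE_nonzero:
  fixes f :: "'a::euclidean_space \<Rightarrow> real"
  assumes f: "real_polynomial_function f" and x0: "f x0 \<noteq> 0"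
  shows "AE x in lborel. f x \<noteq> 0"
proof -
  have cont: "continuous_on UNIV f"
    using continuous_on_polymonial_function f real_polynomial_function_eq by blast
  hence meas[measurable]: "f \<in> borel_measurable borel"
    by (rule borel_measurable_continuous_onI)
  have line: "AE t in lborel. f (x0 + t *\<^sub>R x) \<noteq> 0" for x
  proof -
    have "polynomial_function (\<lambda>t::real. x0 + t *\<^sub>R x)"
      by (intro polynomial_function_add polynomial_function_const polynomial_function_bounded_linear
          bounded_linear_scaleR_left)
    then have "real_polynomial_function (\<lambda>t::real. f (x0 + t *\<^sub>R x))"
      using real_polynomial_function_compose[OF _ f] by (simp add: o_def)
    then obtain a n where a: "(\<lambda>t::real. f (x0 + t *\<^sub>R x)) = (\<lambda>t. \<Sum>i\<le>n. a i * t ^ i)"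
      unfolding real_polynomial_function_iff_sum by blast
    \<comment> \<open>At \<open>t = 0\<close> the polynomial takes the value \<open>f x0\<close>,
      which is nonzero, so its coefficients cannot all vanish.\<close>
    have "\<exists>i\<le>n. a i \<noteq> 0"
    proof (rule ccontr)
      assume "\<not> ?thesis"
      then have "(\<lambda>t. f (x0 + t *\<^sub>R x)) = (\<lambda>t. 0)"
        unfolding a by (intro ext sum.neutral) auto
      from fun_cong[OF this, of 0] x0 show False by simp
    qed
    then have "finite {t. f (x0 + t *\<^sub>R x) = 0}"
      unfolding polyfun_finite_roots[of a n, symmetric] fun_cong[OF a] .
    then have "{t. f (x0 + t *\<^sub>R x) = 0} \<in> null_sets lborel"
      by (rule finite_imp_null_set_lborel)
    from AE_not_in[OF this] show ?thesis by simp
  qed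
  \<comment> \<open>Exchanging the two almost-everywhere quantifiers is Fubini and requires this set
    to be measurable in the product.\<close>
  have "{p \<in> space (lborel \<Otimes>\<^sub>M lborel). f (x0 + snd p *\<^sub>R fst p) \<noteq> 0} \<in> sets (lborel \<Otimes>\<^sub>M lborel)"
    by measurable
  then have "AE t in lborel. AE x in lborel. f (x0 + t *\<^sub>R x) \<noteq> 0"
    by (subst lborel_pair.AE_commute[symmetric]) (use line in simp_all)
  moreover have "AE t::real in lborel. t \<noteq> 0"
    using AE_not_in[of "{0::real}" lborel] by (simp add: finite_imp_null_set_lborel)
  ultimately have "AE t in lborel. t \<noteq> 0 \<and> (AE x in lborel. f (x0 + t *\<^sub>R x) \<noteq> 0)"
    by eventually_elim simp
  moreover have "ae_filter (lborel :: real measure) \<noteq> bot"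
    by (simp add: ae_filter_eq_bot_iff)
  ultimately obtain t :: real where t: "t \<noteq> 0" "AE x in lborel. f (x0 + t *\<^sub>R x) \<noteq> 0"
    using eventually_happens by blast
  \<comment> \<open>For \<open>t \<noteq> 0\<close>, Lebesgue measure is a constant multiple of its
    image under \<open>x \<mapsto> x0 + t x\<close>, so the two measures have the same null
    sets.\<close>
  then show ?thesis
    by (subst lborel_affine[OF t(1), of x0]) (simp add: AE_density AE_distr_iff)
qed

section \<open>Generic invertibility of \<open>Z^T U\<close>\<close>

lemma real_polynomial_function_det:
  fixes F :: "'a::real_normed_vector \<Rightarrow> real^'n^'n"
  assumes "\<And>i j. real_polynomial_function (\<lambda>x. F x $ i $ j)"
  shows "real_polynomial_function (\<lambda>x. det (F x))"
  unfolding det_def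
  by (intro real_polynomial_function_sum real_polynomial_function_prod real_polynomial_function.intros(4)
      real_polynomial_function.intros(2) assms) (auto simp: finite_permutations)

lemma bounded_linear_matrix_nth: "bounded_linear (\<lambda>A :: real^'n^'m. A $ i $ j)"
  using bounded_linear_compose[OF bounded_linear_vec_nth bounded_linear_vec_nth] by blast

lemma AE_det_transpose_mult_nonzero:
  assumes "CARD('r) \<le> CARD('n)"
  shows "AE (Z :: real^'r^'n, U :: real^'r^'n) in lborel. det (transpose Z ** U) \<noteq> 0"
proof -
  obtain h :: "'r \<Rightarrow> 'n" where h: "inj h"
    using assms card_le_inj[of "UNIV::'r set" "UNIV :: 'n set"] by auto
  \<comment> \<open>The columns of \<open>E\<close> are distinct standard basis vectors, hence
    orthonormal; \<open>Z = U = E\<close> is the point where the determinant polynomial does not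
    vanish.\<close>
  define E :: "real^'r^'n" where "E = (\<chi> i j. if i = h j then 1 else 0)"
  have "transpose E ** E = mat 1"
    using h by (auto simp: E_def transpose_def matrix_matrix_mult_def mat_def vec_eq_iff inj_eq
      if_distrib[of "\<lambda>x. x * _"] cong: if_cong)
  then have "det (transpose (fst (E, E)) ** snd (E, E)) \<noteq> 0"
    by simp
  moreover have "real_polynomial_function
      (\<lambda>p :: (real^'r^'n) \<times> (real^'r^'n). det (transpose (fst p) ** snd p))"
  proof (rule real_polynomial_function_det)
    fix i j
    have b: "bounded_linear (\<lambda>p. fst p $ k $ i :: real)" "bounded_linear (\<lambda>p. snd p $ k $ j :: real)"
      for k :: 'n and i j :: 'r
      by (intro bounded_linear_compose[OF bounded_linear_matrix_nth] bounded_linear_fst bounded_linear_snd)+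
    show "real_polynomial_function
        (\<lambda>p :: (real^'r^'n) \<times> (real^'r^'n). (transpose (fst p) ** snd p) $ i $ j)"
      unfolding matrix_matrix_mult_def transpose_def
      by (simp only: vec_lambda_beta)
        (intro real_polynomial_function_sum real_polynomial_function.intros(4)
          real_polynomial_function.intros(1)[OF b(1)] real_polynomial_function.intros(1)[OF b(2)] finite)
  qed
  ultimately have "AE p :: (real^'r^'n) \<times> (real^'r^'n) in lborel. det (transpose (fst p) ** snd p) \<noteq> 0"
    by (rule real_polynomial_function_AE_nonzero[rotated])
  then show ?thesis by (simp add: case_prod_beta)
qed

section \<open>Generic non-invariance of the column space\<close>

text \<open>If every vector were an eigenvector, the basis vectors would force \<open>G\<close> to
  be diagonal, and the sums \<open>e_i + e_j\<close> would force all diagonal entries to agree, so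
  \<open>G\<close> would be scalar.\<close>

lemma ex_non_eigenvector:
  fixes G :: "real^'m^'m"
  assumes "\<And>c. G \<noteq> c *\<^sub>R mat 1"
  shows "\<exists>v. \<forall>c. G *v v \<noteq> c *\<^sub>R v"
proof (rule ccontr)
  assume "\<not> ?thesis"
  then obtain c where c: "G *v v = c v *\<^sub>R v" for v
    by metis
  have entry: "G $ k $ i = (if k = i then c (axis i 1) else 0)" for k i
  proof -
    have "G $ k $ i = (G *v axis i 1) $ k"
      by (simp add: matrix_vector_mult_basis column_def)
    also have "\<dots> = c (axis i 1) * axis i 1 $ k"
      by (simp only: c vector_scaleR_component real_scaleR_def)
    finally show ?thesis
      by (simp add: axis_def)
  qed
  have "c (axis i 1) = c (axis j 1)" for i j
  proof (cases "i = j")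
    case False
    let ?c = "c (axis i 1 + axis j 1)"
    have e: "(G *v (axis i 1 + axis j 1)) $ k = G $ k $ i + G $ k $ j" for k
      by (simp add: matrix_vector_right_distrib matrix_vector_mult_basis column_def)
    have "(G *v (axis i 1 + axis j 1)) $ k = ?c * ((axis i 1 + axis j 1 :: real^'m) $ k)" for k
      by (simp add: c)
    from this[of i] this[of j] show ?thesis
      using False unfolding e entry by (auto simp: axis_def)
  qed simp
  \<comment> \<open>The index \<open>undefined\<close> is an arbitrary choice: all diagonal entries
    are equal.\<close>
  then have "G = c (axis undefined 1) *\<^sub>R mat 1"
    by (auto simp: vec_eq_iff entry mat_def)
  with assms show False by blast
qed

text \<open>The independent pair \<open>v\<close>, \<open>w\<close> extends to a basis, whose
  elements are then listed as the columns of \<open>C\<close> with \<open>v\<close> and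
  \<open>w\<close> in the prescribed positions.\<close>

lemma ex_invertible_two_columns:
  fixes v w :: "real^'m"
  assumes "\<And>c. w \<noteq> c *\<^sub>R v" "v \<noteq> 0" "k0 \<noteq> k1"
  shows "\<exists>C :: real^'m^'m. det C \<noteq> 0 \<and> column k0 C = v \<and> column k1 C = w"
proof -
  have vw: "v \<noteq> w" using assms(1)[of 1] by auto
  have "independent {w, v}"
    using assms by (auto simp: independent_insert span_singleton)
  then obtain T where T: "{w, v} \<subseteq> T" "independent T" "UNIV \<subseteq> span T"
    using maximal_independent_subset_extend[of "{w,v}" UNIV] by auto
  then have fin: "finite T" and card: "card T = CARD('m)"
    using independent_imp_finite basis_card_eq_dim[of T UNIV] by auto
  \<comment> \<open>Both sets arise by deleting two distinct elements from a set of
    \<open>CARD('m)\<close> elements, so the remaining basis vectors can be matched with the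
    remaining columns.\<close>
  have "card (UNIV - {k0, k1}) = card (T - {w, v})"
    using T(1) fin card assms(3) vw by (simp add: card_Diff_subset)
  then obtain h where h: "bij_betw h (UNIV - {k0, k1}) (T - {w, v})"
    using finite_same_card_bij[of "UNIV - {k0, k1}" "T - {w, v}"] fin by auto
  define c where "c k = (if k = k0 then v else if k = k1 then w else h k)" for k
  define C :: "real^'m^'m" where "C = (\<chi> i j. c j $ i)"
  have col: "column j C = c j" for j
    by (simp add: C_def column_def vec_eq_iff)
  have "T \<subseteq> columns C"
  proof
    fix x assume "x \<in> T"
    then consider "x = v" | "x = w" | "x \<in> h ` (UNIV - {k0, k1})"
      using h by (auto simp: bij_betw_def)
    then show "x \<in> columns C"
      using assms(3) by cases (auto simp: columns_def col c_def intro: exI[of _ k0] exI[of _ k1])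
  qed
  then have "span (columns C) = UNIV"
    using T(3) span_mono by blast
  then have "\<exists>B. C ** B = mat 1"
    by (simp add: matrix_right_invertible_span_columns span_vec_eq)
  then have "det C \<noteq> 0"
    by (metis invertible_det_nz invertible_right_inverse)
  then show ?thesis
    using assms(3) by (auto intro!: exI[of _ C] simp: col c_def)
qed

text \<open>Invariance makes a certain determinant, polynomial in \<open>A\<close>, vanish. It is
  not the zero polynomial: a non-eigenvector \<open>v\<close> can be a column of some
  \<open>A0\<close> while \<open>G *v v\<close> stays outside the column space of \<open>A0\<close>,
  for which \<open>r < m\<close> leaves room.\<close>

lemma AE_not_invariant_col_space:
  fixes G :: "real^'m^'m"
  assumes card: "CARD('r) < CARD('m)" and G: "\<And>c. G \<noteq> c *\<^sub>R mat 1"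
  shows "AE A :: real^'r^'m in lborel. \<nexists>B. G ** A = A ** B"
proof -
  obtain h :: "'r \<Rightarrow> 'm" where h: "inj h"
    using card card_le_inj[of "UNIV::'r set" "UNIV :: 'm set"] by auto
  have "range h \<noteq> UNIV"
    using card card_image[OF h] by auto
  then obtain k1 where k1: "k1 \<notin> range h"
    by blast
  define j0 :: 'r where "j0 = undefined"
  obtain v where v: "\<And>c. G *v v \<noteq> c *\<^sub>R v"
    using ex_non_eigenvector[OF G] by blast
  then have "v \<noteq> 0"
    using v[of 0] by auto
  moreover have "h j0 \<noteq> k1"
    using k1 by blast
  ultimately obtain C :: "real^'m^'m" where C: "det C \<noteq> 0" "column (h j0) C = v" "column k1 C = G *v v"
    using ex_invertible_two_columns[OF v] by blast
  \<comment> \<open>If \<open>G A = A B\<close>, column \<open>k1\<close> of \<open>F A\<close> is a combination of the columns in \<open>range h\<close>; the remaining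
    columns are frozen so that \<open>F A0 = C\<close> is invertible for a suitable \<open>A0\<close>.\<close>
  define F :: "real^'r^'m \<Rightarrow> real^'m^'m" where
    "F A = (\<chi> i k. if k = k1 then (G ** A) $ i $ j0
                  else if k \<in> range h then A $ i $ inv h k else C $ i $ k)" for A
  \<comment> \<open>The columns of \<open>C\<close> with index in \<open>range h\<close> form
    \<open>A0\<close>. Its column \<open>j0\<close> is \<open>v\<close>, so column \<open>j0\<close>
    of \<open>G ** A0\<close> is \<open>G *v v\<close>, which is column \<open>k1\<close> of
    \<open>C\<close>.\<close>
  define A0 :: "real^'r^'m" where "A0 = (\<chi> i j. C $ i $ h j)"
  have "(G ** A0) $ i $ j0 = C $ i $ k1" for i
  proof -
    have "(G ** A0) $ i $ j0 = (G *v column (h j0) C) $ i"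
      by (simp add: A0_def matrix_matrix_mult_def matrix_vector_mult_def column_def)
    also have "\<dots> = column k1 C $ i"
      by (simp add: C)
    finally show ?thesis
      by (simp add: column_def)
  qed
  then have "F A0 = C"
    using h by (auto simp: F_def A0_def vec_eq_iff)
  then have "det (F A0) \<noteq> 0"
    using C by simp
  moreover have "real_polynomial_function (\<lambda>A. det (F A))"
  proof (rule real_polynomial_function_det)
    fix i k
    have "real_polynomial_function (\<lambda>A. (G ** A) $ i $ j0)"
      unfolding matrix_matrix_mult_def
      by (simp only: vec_lambda_beta)
        (intro real_polynomial_function_sum real_polynomial_function.intros(4)
          real_polynomial_function.intros(2) finite
          real_polynomial_function.intros(1)[OF bounded_linear_matrix_nth])
    then show "real_polynomial_function (\<lambda>A. F A $ i $ k)"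
      by (cases "k = k1"; cases "k \<in> range h")
        (simp_all add: F_def real_polynomial_function.intros(2)
          real_polynomial_function.intros(1)[OF bounded_linear_matrix_nth])
  qed
  ultimately have "AE A in lborel. det (F A) \<noteq> 0"
    by (rule real_polynomial_function_AE_nonzero[rotated])
  then show ?thesis
  proof eventually_elim
    case (elim A)
    show ?case
    proof
      assume "\<exists>B. G ** A = A ** B"
      then obtain B where B: "G ** A = A ** B" by blast
      define x :: "real^'m" where
        "x = (\<chi> k. if k = k1 then -1 else if k \<in> range h then B $ inv h k $ j0 else 0)"
      have "(F A *v x) $ i = 0" for i
      proof -
        have "(F A *v x) $ i = (\<Sum>k\<in>UNIV. F A $ i $ k * x $ k)"
          by (simp add: matrix_vector_mult_def)
        also have "\<dots> = (\<Sum>k\<in>insert k1 (range h). F A $ i $ k * x $ k)"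
          by (intro sum.mono_neutral_right) (auto simp: x_def)
        also have "\<dots> = - (G ** A) $ i $ j0 + (\<Sum>k\<in>range h. F A $ i $ k * x $ k)"
          using k1 by (simp add: F_def x_def)
        also have "(\<Sum>k\<in>range h. F A $ i $ k * x $ k) = (\<Sum>j\<in>UNIV. F A $ i $ h j * x $ h j)"
          using h by (simp add: sum.reindex)
        also have "\<dots> = (\<Sum>j\<in>UNIV. A $ i $ j * B $ j $ j0)"
        proof (rule sum.cong)
          fix j
          have "h j \<noteq> k1" using k1 by blast
          then show "F A $ i $ h j * x $ h j = A $ i $ j * B $ j $ j0"
            using h by (simp add: F_def x_def)
        qed simp
        also have "\<dots> = (A ** B) $ i $ j0"
          by (simp add: matrix_matrix_mult_def)
        finally show ?thesis
          by (simp add: B)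
      qed
      then have "F A *v x = 0"
        by (simp add: vec_eq_iff)
      moreover have "invertible (F A)"
        using elim by (simp add: invertible_det_nz)
      ultimately have "x = 0"
        using matrix_left_invertible_ker invertible_left_inverse by blast
      then have "x $ k1 = 0"
        by simp
      then show False
        by (simp add: x_def)
    qed
  qed
qed

section \<open>Disintegration along a regular conditional distribution\<close>

text \<open>Both sides are finite measures in \<open>E\<close> that agree on measurable rectangles
  by the defining property of conditional expectation, and rectangles form an intersection-stable
  generator. The formula allows the null set of values of \<open>Y\<close> to vary with
  \<open>X\<close>, as the invariance condition does.\<close>

lemma emeasure_regular_cond_distr:
  fixes X :: "'w \<Rightarrow> 'a::second_countable_topology" and Y :: "'w \<Rightarrow> 'b::second_countable_topology"
  assumes M: "prob_space M"
    and X[measurable]: "X \<in> borel_measurable M" and Y[measurable]: "Y \<in> borel_measurable M"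
    and \<kappa>: "regular_cond_distr M X Y \<kappa>"
    and E: "E \<in> sets borel"
  shows "emeasure M {\<omega> \<in> space M. (X \<omega>, Y \<omega>) \<in> E}
    = (\<integral>\<^sup>+\<omega>. emeasure (\<kappa> (X \<omega>)) {y. (X \<omega>, y) \<in> E} \<partial>M)"
proof -
  interpret prob_space M by fact
  define F where "F = vimage_algebra (space M) X borel"
  have sub: "subalgebra M F"
    unfolding F_def subalgebra_def
    using measurable_iff_sets[of X M borel] X by simp
  interpret finite_measure_subalgebra M F
    by unfold_locales (rule sub)
  have \<kappa>m[measurable]: "\<kappa> \<in> borel \<rightarrow>\<^sub>M subprob_algebra borel"
    using \<kappa> by (auto simp: regular_cond_distr_def intro: measurable_prob_algebraD)
  have \<kappa>s[simp]: "sets (\<kappa> x) = sets borel" "space (\<kappa> x) = UNIV" and \<kappa>p: "prob_space (\<kappa> x)" for x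
  proof -
    have "\<kappa> x \<in> space (prob_algebra borel)"
      using \<kappa> by (auto simp: regular_cond_distr_def dest: measurable_space)
    then show s: "sets (\<kappa> x) = sets borel" and "prob_space (\<kappa> x)"
      by (auto simp: space_prob_algebra)
    show "space (\<kappa> x) = UNIV"
      using sets_eq_imp_space_eq[OF s] by simp
  qed
  let ?B = "borel \<Otimes>\<^sub>M borel :: ('a \<times> 'b) measure"
  let ?\<kappa> = "\<lambda>x. distr (\<kappa> x) ?B (Pair x)"
  define P where "P = distr M ?B (\<lambda>\<omega>. (X \<omega>, Y \<omega>))"
  \<comment> \<open>\<open>N\<close> is the joint law rebuilt from the law of \<open>X\<close> and
    the kernel; \<open>P\<close> is the actual joint law.\<close>
  define N where "N = distr M borel X \<bind> ?\<kappa>"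
  have km: "?\<kappa> \<in> borel \<rightarrow>\<^sub>M subprob_algebra ?B"
    by (rule measurable_distr2[OF _ \<kappa>m]) simp
  have em: "emeasure N S = (\<integral>\<^sup>+\<omega>. emeasure (\<kappa> (X \<omega>)) {y. (X \<omega>, y) \<in> S} \<partial>M)"
    if S: "S \<in> sets ?B" for S
  proof -
    have "emeasure N S = (\<integral>\<^sup>+x. emeasure (?\<kappa> x) S \<partial>distr M borel X)"
      unfolding N_def using km S not_empty by (intro emeasure_bind) auto
    also have "\<dots> = (\<integral>\<^sup>+\<omega>. emeasure (?\<kappa> (X \<omega>)) S \<partial>M)"
      using km S by (intro nn_integral_distr X measurable_emeasure_subprob_algebra[THEN measurable_compose[rotated]]) auto
    also have "\<dots> = (\<integral>\<^sup>+\<omega>. emeasure (\<kappa> (X \<omega>)) {y. (X \<omega>, y) \<in> S} \<partial>M)"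
      using S by (intro nn_integral_cong) (subst emeasure_distr, auto simp: vimage_def)
    finally show ?thesis .
  qed
  have "P = N"
  proof (rule measure_eqI_generator_eq[where A = "\<lambda>_. UNIV" and \<Omega> = UNIV
        and E = "{a \<times> b | a b. a \<in> sets (borel :: 'a measure) \<and> b \<in> sets (borel :: 'b measure)}"])
    show "Int_stable {a \<times> b | a b. a \<in> sets (borel :: 'a measure) \<and> b \<in> sets (borel :: 'b measure)}"
      by (rule Int_stable_pair_measure_generator)
    show "sets P = sigma_sets UNIV {a \<times> b | a b. a \<in> sets (borel :: 'a measure) \<and> b \<in> sets (borel :: 'b measure)}"
      by (simp add: P_def sets_pair_measure)
    show "sets N = sigma_sets UNIV {a \<times> b | a b. a \<in> sets (borel :: 'a measure) \<and> b \<in> sets (borel :: 'b measure)}"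
      unfolding N_def using km not_empty
      by (subst sets_bind[where N = ?B]) (auto simp: sets_pair_measure dest: measurable_space sets_kernel)
    show "range (\<lambda>_::nat. UNIV) \<subseteq> {a \<times> b | a b. a \<in> sets (borel :: 'a measure) \<and> b \<in> sets (borel :: 'b measure)}"
      by (auto intro!: exI[of _ UNIV])
    show "emeasure P UNIV \<noteq> \<infinity>"
      using finite_measure.emeasure_finite[OF prob_space.finite_measure[OF prob_space_distr, of _ ?B]]
      by (simp add: P_def)
  next
    fix S assume "S \<in> {a \<times> b | a b. a \<in> sets (borel :: 'a measure) \<and> b \<in> sets (borel :: 'b measure)}"
    then obtain C D where S: "S = C \<times> D" and C[measurable]: "C \<in> sets borel" and D[measurable]: "D \<in> sets borel"
      by auto
    define C' where "C' = X -` C \<inter> space M"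
    have C': "C' \<in> sets F"
      unfolding C'_def F_def by (rule in_vimage_algebra) fact
    then have C'M[measurable]: "C' \<in> sets M"
      using sub by (auto simp: subalgebra_def)
    have int: "integrable M (\<lambda>\<omega>. indicator D (Y \<omega>) :: real)"
      by (intro integrable_const_bound[where B = 1]) auto
    have meas[measurable]: "(\<lambda>\<omega>. measure (\<kappa> (X \<omega>)) D) \<in> borel_measurable M"
      by (rule measurable_compose[OF X]) (rule measurable_compose[OF \<kappa>m measurable_measure_subprob_algebra[OF D]])
    have "measure M {\<omega> \<in> space M. X \<omega> \<in> C \<and> Y \<omega> \<in> D} = (\<integral>\<omega>. indicator {\<omega> \<in> space M. X \<omega> \<in> C \<and> Y \<omega> \<in> D} \<omega> \<partial>M)"
      by simp
    also have "\<dots> = (\<integral>\<omega>\<in>C'. indicator D (Y \<omega>) \<partial>M)"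
      unfolding set_lebesgue_integral_def
      by (intro Bochner_Integration.integral_cong) (auto simp: C'_def indicator_def)
    \<comment> \<open>Since \<open>C'\<close> belongs to the sigma-algebra generated by
      \<open>X\<close>, the integrand may be replaced by its conditional expectation.\<close>
    also have "\<dots> = (\<integral>\<omega>\<in>C'. real_cond_exp M F (\<lambda>\<omega>. indicator D (Y \<omega>)) \<omega> \<partial>M)"
      by (rule real_cond_exp_intA[OF int C'])
    also have "\<dots> = (\<integral>\<omega>\<in>C'. measure (\<kappa> (X \<omega>)) D \<partial>M)"
      using \<kappa> D unfolding set_lebesgue_integral_def regular_cond_distr_def F_def[symmetric]
      by (intro integral_cong_AE) (auto simp: borel_measurable_cond_exp2)
    finally have eq: "measure M {\<omega> \<in> space M. X \<omega> \<in> C \<and> Y \<omega> \<in> D} = (\<integral>\<omega>. indicator C' \<omega> * measure (\<kappa> (X \<omega>)) D \<partial>M)"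
      by (simp add: set_lebesgue_integral_def)
    have "emeasure P S = ennreal (measure M {\<omega> \<in> space M. X \<omega> \<in> C \<and> Y \<omega> \<in> D})"
      unfolding P_def S by (subst emeasure_distr) (auto simp: emeasure_eq_measure intro!: arg_cong[where f = "measure M"])
    also have "\<dots> = (\<integral>\<^sup>+\<omega>. ennreal (indicator C' \<omega> * measure (\<kappa> (X \<omega>)) D) \<partial>M)"
      unfolding eq
      by (intro nn_integral_eq_integral[symmetric] integrable_const_bound[where B = 1])
        (auto simp: indicator_def prob_space.prob_le_1[OF \<kappa>p])
    also have "\<dots> = (\<integral>\<^sup>+\<omega>. emeasure (\<kappa> (X \<omega>)) {y. (X \<omega>, y) \<in> S} \<partial>M)"
      by (intro nn_integral_cong)
        (auto simp: S C'_def indicator_def finite_measure.emeasure_eq_measure[OF prob_space.finite_measure[OF \<kappa>p]])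
    also have "\<dots> = emeasure N S"
      by (rule em[symmetric]) (simp add: S)
    finally show "emeasure P S = emeasure N S" .
  qed auto
  \<comment> \<open>Second countability identifies the Borel sigma-algebra of the product with the
    product sigma-algebra.\<close>
  have E': "E \<in> sets ?B"
    using E by (subst borel_prod)
  have "emeasure M {\<omega> \<in> space M. (X \<omega>, Y \<omega>) \<in> E} = emeasure P E"
    unfolding P_def using E'
    by (subst emeasure_distr) (auto intro!: arg_cong[where f = "emeasure M"])
  then show ?thesis
    using em[OF E'] \<open>P = N\<close> by simp
qed

section \<open>Column spaces, projectors and the ridge inverse\<close>

lemma col_space_eq_range: "col_space A = range ((*v) A)"
proof
  show "col_space A \<subseteq> range ((*v) A)"
    unfolding col_space_def
  proof (rule span_minimal)
    show "columns A \<subseteq> range ((*v) A)"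
      by (auto simp: columns_image_basis)
    show "subspace (range ((*v) A))"
      by (rule linear_subspace_image[OF matrix_vector_mul_linear subspace_UNIV])
  qed
  show "range ((*v) A) \<subseteq> col_space A"
    by (auto simp: col_space_def matrix_vector_mult_in_columnspace)
qed

lemma col_space_subset_iff: "col_space Y \<subseteq> col_space A \<longleftrightarrow> (\<exists>B. Y = A ** B)"
proof
  assume sub: "col_space Y \<subseteq> col_space A"
  have "\<exists>x. column j Y = A *v x" for j
    using sub unfolding col_space_eq_range
    by (metis matrix_vector_mult_basis rangeE rangeI subsetD)
  then obtain b where b: "column j Y = A *v b j" for j
    by metis
  have "Y = A ** (\<chi> i j. b j $ i)"
    using b by (auto simp: vec_eq_iff column_def matrix_vector_mult_def matrix_matrix_mult_def)
  then show "\<exists>B. Y = A ** B" ..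
qed (auto simp: col_space_eq_range matrix_vector_mul_assoc[symmetric])

text \<open>The kernel of the projector onto the complement of a subspace \<open>S\<close> is
  \<open>S\<close> itself, because the double complement of \<open>S\<close> is
  \<open>S\<close>.\<close>

lemma orth_projector_comp_mult_eq_0_iff:
  "orth_projector ((col_space A)\<^sup>\<bottom>) ** Y = 0 \<longleftrightarrow> col_space Y \<subseteq> col_space A"
proof -
  let ?S = "col_space A"
  have S: "subspace ?S"
    by (simp add: col_space_def)
  have Sp: "subspace (?S\<^sup>\<bottom>)"
    by (rule subspace_orthogonal_comp)
  define P where "P = orth_projector (?S\<^sup>\<bottom>)"
  have P: "P *v v \<in> ?S\<^sup>\<bottom>" "v - P *v v \<in> ?S" for v
    using theI'[OF ex1_orth_projector[OF Sp]] orthogonal_comp_self[OF S]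
    unfolding P_def orth_projector_def by auto
  have "P *v v = 0 \<longleftrightarrow> v \<in> ?S" for v
  proof
    assume "P *v v = 0"
    then show "v \<in> ?S"
      using P(2)[of v] by simp
  next
    assume "v \<in> ?S"
    then have "P *v v \<in> ?S"
      using subspace_diff[OF S _ P(2)[of v]] by fastforce
    then have "orthogonal (P *v v) (P *v v)"
      using P(1)[of v] by (auto simp: orthogonal_comp_def)
    then show "P *v v = 0"
      by (simp add: orthogonal_def)
  qed
  then show ?thesis
    unfolding P_def[symmetric] col_space_eq_range[of Y]
    by (auto simp: matrix_eq matrix_vector_mul_assoc[symmetric])
qed

text \<open>The matrix is positive definite: its quadratic form at \<open>x\<close> is
  \<open>|Z x|^2 + lam |x|^2\<close>, so its kernel is trivial.\<close>

lemma invertible_gram_ridge: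
  assumes "lam > 0"
  shows "invertible (gram Z + lam *\<^sub>R mat 1)"
proof -
  have "x = 0" if "(gram Z + lam *\<^sub>R mat 1) *v x = 0" for x
  proof -
    have "(gram Z + lam *\<^sub>R mat 1) *v x = transpose Z *v (Z *v x) + lam *\<^sub>R x"
      by (simp add: gram_def matrix_vector_mult_add_rdistrib matrix_vector_mul_assoc scaleR_matrix_vector_assoc[symmetric])
    with that have "x \<bullet> (transpose Z *v (Z *v x) + lam *\<^sub>R x) = 0"
      by simp
    then have "(Z *v x) \<bullet> (Z *v x) + lam * (x \<bullet> x) = 0"
      by (simp add: inner_add_right dot_lmul_matrix[symmetric] inner_commute)
    moreover have "lam * (x \<bullet> x) \<ge> 0" "(Z *v x) \<bullet> (Z *v x) \<ge> 0"
      using assms by auto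
    ultimately have "lam * (x \<bullet> x) = 0" by linarith
    with assms show "x = 0" by simp
  qed
  then show ?thesis
    by (metis invertible_left_inverse matrix_left_invertible_ker)
qed

lemma matrix_inv_inverse:
  assumes "invertible A"
  shows "A ** matrix_inv A = mat 1" and "matrix_inv A ** A = mat 1"
  using someI_ex[OF assms[unfolded invertible_def]] by (auto simp: matrix_inv_def)

text \<open>Multiplying by the invertible ridge matrix turns the inverse into a polynomial equation.
  This makes the graph of \<open>K_mat\<close> closed and gives access to the determinant of
  \<open>K\<close>.\<close>

lemma eq_K_mat_iff:
  fixes X :: "real^'m^'n" and A :: "real^'r^'m" and U :: "real^'r^'n"
  assumes "lam > 0"
  shows "K = K_mat lam X A U \<longleftrightarrow> (gram (X ** A) + lam *\<^sub>R mat 1) ** K = transpose (X ** A) ** U"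
proof -
  let ?W = "gram (X ** A) + lam *\<^sub>R mat 1"
  have W: "?W ** matrix_inv ?W = mat 1" "matrix_inv ?W ** ?W = mat 1"
    using matrix_inv_inverse[OF invertible_gram_ridge[OF assms]] by auto
  have K: "K_mat lam X A U = matrix_inv ?W ** (transpose (X ** A) ** U)"
    by (simp add: K_mat_def gram_def matrix_transpose_mul matrix_mul_assoc)
  show ?thesis
  proof
    assume "?W ** K = transpose (X ** A) ** U"
    then have "K_mat lam X A U = (matrix_inv ?W ** ?W) ** K"
      unfolding K matrix_mul_assoc[symmetric] by simp
    then show "K = K_mat lam X A U"
      by (simp add: W)
  qed (simp add: K matrix_mul_assoc W)
qed

section \<open>Continuity of matrix operations and almost sure escape from the column space\<close>

lemma continuous_on_matrix_mult [continuous_intros]: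
  fixes F :: "'a::topological_space \<Rightarrow> real^'k^'n" and G :: "'a \<Rightarrow> real^'m^'k"
  assumes "continuous_on S F" "continuous_on S G"
  shows "continuous_on S (\<lambda>x. F x ** G x)"
  unfolding matrix_matrix_mult_def using assms by (intro continuous_intros)

lemma continuous_on_matrix_transpose [continuous_intros]:
  fixes F :: "'a::topological_space \<Rightarrow> real^'k^'n"
  assumes "continuous_on S F"
  shows "continuous_on S (\<lambda>x. transpose (F x))"
  unfolding transpose_def using assms by (intro continuous_intros)

theorem mainTheorem2:
  fixes M :: "'w measure"
    and X :: "'w \<Rightarrow> real^'m^'n"
    and A :: "'w \<Rightarrow> real^'r^'m"
    and U :: "'w \<Rightarrow> real^'r^'n"
    and lam :: real
  assumes "prob_space M"
    and "CARD('r) < CARD('m)"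
    and "CARD('r) \<le> CARD('n)"
    and "lam > 0"
    and "X \<in> borel_measurable M"
    and "A \<in> borel_measurable M"
    and "U \<in> borel_measurable M"
    and "AE \<omega> in M. \<not> (\<exists>c. gram (X \<omega>) = c *\<^sub>R mat 1)"
    and "cond_abs_continuous M X A"
    and "absolutely_continuous lborel (distr M borel (\<lambda>\<omega>. (X \<omega> ** A \<omega>, U \<omega>)))"
  shows "{\<omega> \<in> space M. orth_projector ((col_space (A \<omega>))\<^sup>\<bottom>) ** gram (X \<omega>) ** A \<omega>
             ** K_mat lam (X \<omega>) (A \<omega>) (U \<omega>) = 0} \<in> sets M
    \<and> \<P>(\<omega> in M. orth_projector ((col_space (A \<omega>))\<^sup>\<bottom>) ** gram (X \<omega>) ** A \<omega>
             ** K_mat lam (X \<omega>) (A \<omega>) (U \<omega>) = 0) = 0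
    \<and> (\<forall>eta>0. AE \<omega> in M.
         \<not> col_space (A \<omega> - eta *\<^sub>R (gram (X \<omega>) ** A \<omega> ** K_mat lam (X \<omega>) (A \<omega>) (U \<omega>)))
             \<subseteq> col_space (A \<omega>))"
proof -
  interpret prob_space M by fact
  note [measurable] = assms(5,6,7)
  define Y where "Y \<omega> = gram (X \<omega>) ** A \<omega> ** K_mat lam (X \<omega>) (A \<omega>) (U \<omega>)" for \<omega>
  have event: "orth_projector ((col_space (A \<omega>))\<^sup>\<bottom>) ** gram (X \<omega>) ** A \<omega>
      ** K_mat lam (X \<omega>) (A \<omega>) (U \<omega>) = 0 \<longleftrightarrow> (\<exists>B. Y \<omega> = A \<omega> ** B)" for \<omega>
    using orth_projector_comp_mult_eq_0_iff[of "A \<omega>" "Y \<omega>"]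
    by (simp add: Y_def matrix_mul_assoc col_space_subset_iff)

  \<comment> \<open>Borel measurability of the event: it is a projection of a closed set along a Euclidean factor,
    hence an \<open>F\<^sub>\<sigma>\<close>; this avoids the measurability of \<open>matrix_inv\<close> and \<open>orth_projector\<close>.\<close>
  define T :: "(((real^'r^'r) \<times> (real^'r^'r)) \<times> (real^'m^'n) \<times> (real^'r^'m) \<times> (real^'r^'n)) set" where
    "T = {((K, B), x, a, u). (gram (x ** a) + lam *\<^sub>R mat 1) ** K = transpose (x ** a) ** u
        \<and> gram x ** a ** K = a ** B}"
  have "closed T"
    unfolding T_def gram_def case_prod_beta
    by (intro closed_Collect_conj closed_Collect_eq continuous_intros)
  then have "{p. \<exists>q. (q, p) \<in> T} \<in> sets borel"
    by (rule borel_closed_projection)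
  then have "(\<lambda>\<omega>. (X \<omega>, A \<omega>, U \<omega>)) -` {p. \<exists>q. (q, p) \<in> T} \<inter> space M \<in> sets M"
    by (intro measurable_sets[of _ M borel]) auto
  also have "(\<lambda>\<omega>. (X \<omega>, A \<omega>, U \<omega>)) -` {p. \<exists>q. (q, p) \<in> T} \<inter> space M
      = {\<omega> \<in> space M. \<exists>B. Y \<omega> = A \<omega> ** B}"
    by (auto simp: T_def Y_def eq_K_mat_iff[OF \<open>lam > 0\<close>, symmetric])
  finally have sets: "{\<omega> \<in> space M. \<exists>B. Y \<omega> = A \<omega> ** B} \<in> sets M" .
  obtain \<kappa> where \<kappa>: "regular_cond_distr M X A \<kappa>"
      and ac: "AE \<omega> in M. absolutely_continuous lborel (\<kappa> (X \<omega>))"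
    using assms(9) by (auto simp: cond_abs_continuous_def)
  \<comment> \<open>The section of \<open>E\<close> at \<open>x\<close> consists of the matrices
    whose column space is invariant under \<open>gram x\<close>; it is Lebesgue null whenever
    \<open>gram x\<close> is not scalar.\<close>
  define E :: "((real^'m^'n) \<times> (real^'r^'m)) set" where "E = {(x, a). \<exists>B. gram x ** a = a ** B}"
  have "closed {(B :: real^'r^'r, x :: real^'m^'n, a :: real^'r^'m). gram x ** a = a ** B}"
    unfolding gram_def case_prod_beta by (intro closed_Collect_eq continuous_intros)
  from borel_closed_projection[OF this] have E: "E \<in> sets borel"
    by (simp add: E_def case_prod_beta')
  have "AE \<omega> in M. emeasure (\<kappa> (X \<omega>)) {a. (X \<omega>, a) \<in> E} = 0"
    using ac assms(8)
  proof eventually_elim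
    case (elim \<omega>)
    have "AE a :: real^'r^'m in lborel. \<nexists>B. gram (X \<omega>) ** a = a ** B"
      using AE_not_invariant_col_space[OF assms(2)] elim(2) by blast
    moreover have "{a. (X \<omega>, a) \<in> E} \<in> sets lborel"
      using measurable_sets[of "Pair (X \<omega>)" borel borel E] E by (simp add: vimage_def)
    ultimately have "{a. (X \<omega>, a) \<in> E} \<in> null_sets lborel"
      by (subst AE_iff_null_sets) (auto simp: E_def)
    with elim(1) show ?case
      unfolding absolutely_continuous_def by blast
  qed
  then have "emeasure M {\<omega> \<in> space M. (X \<omega>, A \<omega>) \<in> E} = 0"
    unfolding emeasure_regular_cond_distr[OF assms(1,5,6) \<kappa> E]
    by (subst nn_integral_cong_AE) auto
  moreover have "{\<omega> \<in> space M. (X \<omega>, A \<omega>) \<in> E} \<in> sets M"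
    using measurable_sets[of "\<lambda>\<omega>. (X \<omega>, A \<omega>)" M borel E] E by (simp add: vimage_def Int_def conj_commute)
  ultimately have not_inv: "AE \<omega> in M. \<nexists>B. gram (X \<omega>) ** A \<omega> = A \<omega> ** B"
    by (subst AE_iff_measurable[OF _ refl]) (auto simp: E_def)

  have ZU: "(\<lambda>\<omega>. (X \<omega> ** A \<omega>, U \<omega>)) \<in> borel_measurable M"
  proof -
    have "continuous_on UNIV (\<lambda>p :: (real^'m^'n) \<times> (real^'r^'m). fst p ** snd p)"
      by (intro continuous_intros)
    then have [measurable]: "(\<lambda>p :: (real^'m^'n) \<times> (real^'r^'m). fst p ** snd p) \<in> borel_measurable borel"
      by (rule borel_measurable_continuous_onI)
    have [measurable]: "(\<lambda>\<omega>. (X \<omega>, A \<omega>)) \<in> borel_measurable M"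
      by measurable
    have "(\<lambda>\<omega>. X \<omega> ** A \<omega>) \<in> borel_measurable M"
      using measurable_compose[OF \<open>(\<lambda>\<omega>. (X \<omega>, A \<omega>)) \<in> _\<close> \<open>_ \<in> borel_measurable borel\<close>] by simp
    then show ?thesis
      by measurable
  qed
  \<comment> \<open>Absolute continuity transfers the Lebesgue-generic invertibility of
    \<open>Z^T U\<close> to the joint law of \<open>(Z, U)\<close>.\<close>
  have "AE p in distr M borel (\<lambda>\<omega>. (X \<omega> ** A \<omega>, U \<omega>)). case p of (Z, u) \<Rightarrow> det (transpose Z ** u) \<noteq> 0"
    by (rule absolutely_continuous_AE[OF _ assms(10) AE_det_transpose_mult_nonzero[OF assms(3)]]) simp
  then have "AE \<omega> in M. det (transpose (X \<omega> ** A \<omega>) ** U \<omega>) \<noteq> 0"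
    using AE_distrD[OF ZU] by fastforce
  with not_inv have not_sub: "AE \<omega> in M. \<nexists>B. Y \<omega> = A \<omega> ** B"
  proof eventually_elim
    case (elim \<omega>)
    let ?K = "K_mat lam (X \<omega>) (A \<omega>) (U \<omega>)"
    \<comment> \<open>The right-hand side is nonzero, so the factor \<open>det ?K\<close> is nonzero
      as well.\<close>
    have "det (gram (X \<omega> ** A \<omega>) + lam *\<^sub>R mat 1) * det ?K = det (transpose (X \<omega> ** A \<omega>) ** U \<omega>)"
      by (simp only: det_mul[symmetric] eq_K_mat_iff[OF \<open>lam > 0\<close>, THEN iffD1, OF refl])
    then have "invertible ?K"
      using elim(2) by (auto simp: invertible_det_nz)
    \<comment> \<open>If \<open>Y = A B\<close>, cancelling the invertible \<open>K\<close> gives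
      \<open>gram X ** A = A (B K^-1)\<close>, the excluded invariance.\<close>
    then have "gram (X \<omega>) ** A \<omega> = Y \<omega> ** matrix_inv ?K"
      by (simp add: Y_def matrix_mul_assoc[symmetric] matrix_inv_inverse)
    with elim(1) show ?case
      by (metis matrix_mul_assoc)
  qed
  have "\<P>(\<omega> in M. \<exists>B. Y \<omega> = A \<omega> ** B) = 0"
    using not_sub sets by (subst prob_eq_0) auto
  moreover have "AE \<omega> in M. \<not> col_space (A \<omega> - eta *\<^sub>R Y \<omega>) \<subseteq> col_space (A \<omega>)" if "eta > 0" for eta
    using not_sub
  proof eventually_elim
    case (elim \<omega>)
    show ?case
    proof
      assume "col_space (A \<omega> - eta *\<^sub>R Y \<omega>) \<subseteq> col_space (A \<omega>)"
      then obtain B where AB: "A \<omega> - eta *\<^sub>R Y \<omega> = A \<omega> ** B"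
        unfolding col_space_subset_iff by blast
      \<comment> \<open>Solving \<open>A - eta Y = A B\<close> for \<open>Y\<close> gives
        \<open>Y = A ((1 / eta) (I - B))\<close>, a factorization that almost surely does not
        exist.\<close>
      have "A \<omega> ** (mat 1 - B) = A \<omega> - A \<omega> ** B"
        by (simp add: eq_diff_eq matrix_add_ldistrib[symmetric])
      also have "\<dots> = eta *\<^sub>R Y \<omega>"
        by (simp flip: AB)
      finally have "A \<omega> ** ((1 / eta) *\<^sub>R (mat 1 - B)) = (1 / eta) *\<^sub>R (eta *\<^sub>R Y \<omega>)"
        by (simp only: matrix_scalar_ac scalar_matrix_assoc[symmetric])
      then have "Y \<omega> = A \<omega> ** ((1 / eta) *\<^sub>R (mat 1 - B))"
        using that by simp
      with elim show False by blast
    qed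
  qed
  ultimately show ?thesis
    using sets unfolding event Y_def[symmetric] by blast
qed

end
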